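(* Assume the Continuum Hypothesis. Then there is an automorphism $\phi$ of $\mathcal P(\omega)/\mathrm{Fin}$ such that $\phi\circ\sigma=\sigma\circ\phi$ but $\phi\neq\sigma^n$ for every $n\in\mathbb Z$.
   Context: $\mathcal P(\omega)/\mathrm{Fin}$ is $\mathcal P(\omega)$ modulo finite sets, $[A]$ the class of $A$, and $\sigma([A])=[A+1]$ the shift automorphism. *)

theory Defs
  imports Complex_Main
begin

unbundle cardinal_syntax

text \<open>The cardinal of the continuum is \<open>\<aleph>\<^sub>1\<close>, the successor cardinal of \<open>natLeq\<close>.\<close>
definition CH :: bool where
  "CH \<longleftrightarrow> |UNIV :: nat set set| =o cardSuc natLeq"

definition eq_mod_fin :: "nat set \<Rightarrow> nat set \<Rightarrow> bool" where
  "eq_mod_fin A B \<longleftrightarrow> finite ((A - B) \<union> (B - A))"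

quotient_type pfin = "nat set" / eq_mod_fin
  morphisms rep_pfin cls
proof (rule equivpI)
  show "reflp eq_mod_fin"
    by (simp add: reflp_def eq_mod_fin_def)
  show "symp eq_mod_fin"
    by (simp add: symp_def eq_mod_fin_def)
  show "transp eq_mod_fin"
  proof (rule transpI)
    fix A B C
    assume "eq_mod_fin A B" "eq_mod_fin B C"
    then have "finite (((A - B) \<union> (B - A)) \<union> ((B - C) \<union> (C - B)))"
      by (simp add: eq_mod_fin_def)
    then show "eq_mod_fin A C"
      unfolding eq_mod_fin_def by (rule rev_finite_subset) blast
  qed
qed

instantiation pfin :: boolean_algebra
begin

lift_definition bot_pfin :: pfin is "{}" .

lift_definition top_pfin :: pfin is "UNIV" .

lift_definition uminus_pfin :: "pfin \<Rightarrow> pfin" is "\<lambda>A. - A"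
  unfolding eq_mod_fin_def by (erule rev_finite_subset) blast

lift_definition inf_pfin :: "pfin \<Rightarrow> pfin \<Rightarrow> pfin" is "(\<inter>)"
proof -
  fix A B C D :: "nat set"
  assume "eq_mod_fin A B" "eq_mod_fin C D"
  then have "finite (((A - B) \<union> (B - A)) \<union> ((C - D) \<union> (D - C)))"
    by (simp add: eq_mod_fin_def)
  then show "eq_mod_fin (A \<inter> C) (B \<inter> D)"
    unfolding eq_mod_fin_def by (rule rev_finite_subset) blast
qed

lift_definition sup_pfin :: "pfin \<Rightarrow> pfin \<Rightarrow> pfin" is "(\<union>)"
proof -
  fix A B C D :: "nat set"
  assume "eq_mod_fin A B" "eq_mod_fin C D"
  then have "finite (((A - B) \<union> (B - A)) \<union> ((C - D) \<union> (D - C)))"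
    by (simp add: eq_mod_fin_def)
  then show "eq_mod_fin (A \<union> C) (B \<union> D)"
    unfolding eq_mod_fin_def by (rule rev_finite_subset) blast
qed

definition minus_pfin :: "pfin \<Rightarrow> pfin \<Rightarrow> pfin" where
  "minus_pfin a b = inf a (- b)"

lift_definition less_eq_pfin :: "pfin \<Rightarrow> pfin \<Rightarrow> bool" is "\<lambda>A B. finite (A - B)"
proof -
  fix A B C D :: "nat set"
  assume "eq_mod_fin A B" "eq_mod_fin C D"
  then have fin: "finite (((A - B) \<union> (B - A)) \<union> ((C - D) \<union> (D - C)))"
    by (simp add: eq_mod_fin_def)
  show "finite (A - C) \<longleftrightarrow> finite (B - D)"
  proof
    assume "finite (A - C)"
    with fin have "finite ((A - C) \<union> (((A - B) \<union> (B - A)) \<union> ((C - D) \<union> (D - C))))"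
      by simp
    then show "finite (B - D)" by (rule rev_finite_subset) blast
  next
    assume "finite (B - D)"
    with fin have "finite ((B - D) \<union> (((A - B) \<union> (B - A)) \<union> ((C - D) \<union> (D - C))))"
      by simp
    then show "finite (A - C)" by (rule rev_finite_subset) blast
  qed
qed

definition less_pfin :: "pfin \<Rightarrow> pfin \<Rightarrow> bool" where
  "less_pfin a b \<longleftrightarrow> a \<le> b \<and> \<not> b \<le> a"

instance
proof
  fix x y z :: pfin
  show "x < y \<longleftrightarrow> x \<le> y \<and> \<not> y \<le> x" by (simp add: less_pfin_def)
  show "x \<le> x" by transfer simp
  show "x \<le> z" if "x \<le> y" "y \<le> z"
    using that
  proof transfer
    fix A B C :: "nat set"
    assume "finite (A - B)" "finite (B - C)"
    then have "finite ((A - B) \<union> (B - C))" by simp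
    then show "finite (A - C)" by (rule rev_finite_subset) blast
  qed
  show "x = y" if "x \<le> y" "y \<le> x"
    using that by transfer (simp add: eq_mod_fin_def)
  show "inf x y \<le> x" by transfer (rule finite_subset[of _ "{}"], auto)
  show "inf x y \<le> y" by transfer (rule finite_subset[of _ "{}"], auto)
  show "x \<le> inf y z" if "x \<le> y" "x \<le> z"
    using that by transfer (simp add: Diff_Int)
  show "x \<le> sup x y" by transfer (rule finite_subset[of _ "{}"], auto)
  show "y \<le> sup x y" by transfer (rule finite_subset[of _ "{}"], auto)
  show "sup y z \<le> x" if "y \<le> x" "z \<le> x"
    using that by transfer (simp add: Un_Diff)
  show "bot \<le> x" by transfer simp
  show "x \<le> top" by transfer simp
  show "sup x (inf y z) = inf (sup x y) (sup x z)"
    by transfer (simp add: eq_mod_fin_def Un_Int_distrib)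
  show "inf x (- x) = bot" by transfer (simp add: eq_mod_fin_def)
  show "sup x (- x) = top" by transfer (simp add: eq_mod_fin_def)
  show "x - y = inf x (- y)" by (simp add: minus_pfin_def)
qed

end

definition ba_automorphism :: "('a::boolean_algebra \<Rightarrow> 'a) \<Rightarrow> bool" where
  "ba_automorphism f \<longleftrightarrow>
     bij f \<and>
     (\<forall>x y. f (inf x y) = inf (f x) (f y)) \<and>
     (\<forall>x y. f (sup x y) = sup (f x) (f y)) \<and>
     (\<forall>x. f (- x) = - f x) \<and>
     f bot = bot \<and> f top = top"

lift_definition shift :: "pfin \<Rightarrow> pfin" is "\<lambda>A. (\<lambda>n. n + 1) ` A"
proof -
  fix A B :: "nat set"
  assume "eq_mod_fin A B"
  then have "finite ((\<lambda>n. n + 1) ` ((A - B) \<union> (B - A)))"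
    by (simp add: eq_mod_fin_def)
  then show "eq_mod_fin ((\<lambda>n. n + 1) ` A) ((\<lambda>n. n + 1) ` B)"
    unfolding eq_mod_fin_def by (rule rev_finite_subset) blast
qed

lemma shift_cls: "shift (cls A) = cls ((\<lambda>n. n + 1) ` A)"
  by (fact shift.abs_eq)

lemma bij_shift: "bij shift"
proof (rule bijI)
  show "inj shift"
  proof (rule injI)
    fix x y
    assume "shift x = shift y"
    then show "x = y"
    proof transfer
      fix A B :: "nat set"
      assume "eq_mod_fin ((\<lambda>n. n + 1) ` A) ((\<lambda>n. n + 1) ` B)"
      then have "finite ((\<lambda>n. n + 1) ` ((A - B) \<union> (B - A)))"
        unfolding eq_mod_fin_def by (rule rev_finite_subset) auto
      then show "eq_mod_fin A B"
        unfolding eq_mod_fin_def by (rule finite_imageD) (simp add: inj_on_def)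
    qed
  qed
  have "\<exists>x. shift x = y" for y
  proof transfer
    fix A :: "nat set"
    have "(\<lambda>n. n + 1) ` {n. n + 1 \<in> A} = A - {0}"
    proof (intro equalityI subsetI)
      fix m
      assume "m \<in> A - {0}"
      then show "m \<in> (\<lambda>n. n + 1) ` {n. n + 1 \<in> A}"
        by (intro image_eqI[of _ _ "m - 1"]) auto
    qed auto
    moreover have "eq_mod_fin (A - {0}) A"
      unfolding eq_mod_fin_def by (rule finite_subset[of _ "{0}"]) auto
    ultimately have "eq_mod_fin ((\<lambda>n. n + 1) ` {n. n + 1 \<in> A}) A"
      by simp
    then show "\<exists>B. eq_mod_fin ((\<lambda>n. n + 1) ` B) A" ..
  qed
  then show "surj shift" by (metis surjI)
qed

lemma ba_automorphism_shift: "ba_automorphism shift"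
  unfolding ba_automorphism_def
proof (intro conjI allI)
  show "bij shift" by (fact bij_shift)
  fix x y :: pfin
  show "shift (inf x y) = inf (shift x) (shift y)"
    by transfer (simp add: eq_mod_fin_def image_Int)
  show "shift (sup x y) = sup (shift x) (shift y)"
    by transfer (simp add: eq_mod_fin_def image_Un)
  have range: "m \<in> range (\<lambda>n. n + 1)" if "m \<noteq> 0" for m :: nat
    using that by (intro image_eqI[of _ _ "m - 1"]) auto
  show "shift (- x) = - shift x"
  proof transfer
    fix A :: "nat set"
    have "(\<lambda>n. n + 1) ` (- A) \<inter> (\<lambda>n. n + 1) ` A = {}"
      by auto
    moreover have "(\<lambda>n. n + 1) ` (- A) \<union> (\<lambda>n. n + 1) ` A = range (\<lambda>n. n + 1)"
      by blast
    ultimately have "(\<lambda>n. n + 1) ` (- A) - (- (\<lambda>n. n + 1) ` A) \<union>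
        (- (\<lambda>n. n + 1) ` A - (\<lambda>n. n + 1) ` (- A)) \<subseteq> {0}"
      using range by blast
    then show "eq_mod_fin ((\<lambda>n. n + 1) ` (- A)) (- (\<lambda>n. n + 1) ` A)"
      unfolding eq_mod_fin_def by (rule finite_subset) simp
  qed
  show "shift bot = bot" by transfer (simp add: eq_mod_fin_def)
  show "shift top = top"
  proof transfer
    show "eq_mod_fin (range (\<lambda>n. n + 1)) UNIV"
      unfolding eq_mod_fin_def by (rule finite_subset[of _ "{0}"]) (use range in blast, simp)
  qed
qed

text \<open>Integer power of a bijection under composition; junk for negative exponents if
  \<open>f\<close> is not bijective.\<close>
definition int_funpow :: "('a \<Rightarrow> 'a) \<Rightarrow> int \<Rightarrow> 'a \<Rightarrow> 'a" where
  "int_funpow f n = (if 0 \<le> n then f ^^ nat n else inv f ^^ nat (- n))"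

end

theory Submission
  imports Defs "HOL-Library.Countable_Set"
begin

text \<open>
  A countable partial map \<open>f\<close> between subsets of \<open>\<omega>\<close> is kept together with an infinite increasing
  sequence of cut pairs \<open>(p\<^sub>i, q\<^sub>i)\<close> such that the intervals \<open>[p\<^sub>i, p\<^sub>i\<^sub>+\<^sub>1]\<close> and \<open>[q\<^sub>i, q\<^sub>i\<^sub>+\<^sub>1]\<close>, coloured
  by a finite part of \<open>f\<close>, are equivalent for the Ehrenfeucht-Fraisse game on subsets of every
  prescribed length once \<open>i\<close> is large. Playing one round on each interval adds a given set to the
  domain or the range of \<open>f\<close>, and a pseudo-intersection of the sequences takes care of countable
  limits, so under CH a recursion of length \<open>\<omega>\<^sub>1\<close> makes \<open>f\<close> total and onto. Since the game sees
  successors, \<open>f\<close> induces an automorphism commuting with the shift. There are only finitely many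
  types of intervals of a given game length, so the recursion can start with a map
  \<open>{p\<^sub>i} \<mapsto> {q\<^sub>i}\<close> where \<open>q\<^sub>i - p\<^sub>i\<close> and \<open>p\<^sub>i\<^sub>+\<^sub>1 - q\<^sub>i\<close> tend to infinity; no power of the shift acts like this.
\<close>

section \<open>The set game on a pair of intervals\<close>

definition agree :: "(nat set \<times> nat set) set \<Rightarrow> nat \<Rightarrow> nat \<Rightarrow> bool" where
  "agree R m n \<longleftrightarrow> (\<forall>(A, B)\<in>R. m \<in> A \<longleftrightarrow> n \<in> B)"

text \<open>
  Duplicator wins the game with \<open>k\<close> rounds, a move being a set, on the closed intervals
  \<open>[fst u, fst v]\<close> and \<open>[snd u, snd v]\<close> with the pairs in \<open>R\<close> already played. Pairs of successive
  points, rather than points, are compared at the end, so that the game sees the shift. Both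
  endpoints belong to the interval: this lets the answers on consecutive intervals be glued.
\<close>
fun similar :: "nat \<Rightarrow> (nat set \<times> nat set) set \<Rightarrow> nat \<times> nat \<Rightarrow> nat \<times> nat \<Rightarrow> bool" where
  "similar 0 R u v \<longleftrightarrow>
     agree R (fst u) (snd u) \<and> agree R (fst v) (snd v) \<and>
     (\<forall>m\<in>{fst u..<fst v}. \<exists>n\<in>{snd u..<snd v}. agree R m n \<and> agree R (Suc m) (Suc n)) \<and>
     (\<forall>n\<in>{snd u..<snd v}. \<exists>m\<in>{fst u..<fst v}. agree R m n \<and> agree R (Suc m) (Suc n))"
| "similar (Suc k) R u v \<longleftrightarrow>
     (\<forall>X. \<exists>Y. similar k (insert (X, Y) R) u v) \<and> (\<forall>Y. \<exists>X. similar k (insert (X, Y) R) u v)"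

text \<open>Only traces on the two closed intervals matter for the game, so a strategy survives
  translation, by different amounts on the two sides. Letting every pair of \<open>R'\<close> copy
  some pair of \<open>R\<close> also covers dropping pairs and altering sets outside the
  intervals.\<close>

lemma similar_translate:
  assumes "similar k R u v"
    and "\<And>A' B'. (A', B') \<in> R' \<Longrightarrow> \<exists>(A, B)\<in>R.
           (\<forall>n\<in>{fst u..fst v}. n + a \<in> A' \<longleftrightarrow> n \<in> A) \<and> (\<forall>n\<in>{snd u..snd v}. n + b \<in> B' \<longleftrightarrow> n \<in> B)"
    and "fst u \<le> fst v" "snd u \<le> snd v"
  shows "similar k R' (fst u + a, snd u + b) (fst v + a, snd v + b)"
  using assms
proof (induction k arbitrary: R R')
  case 0
  have ag: "agree R' (m + a) (n + b)"
    if "agree R m n" "m \<in> {fst u..fst v}" "n \<in> {snd u..snd v}" for m n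
    using that 0(2) unfolding agree_def by fastforce
  have 1: "\<exists>n'\<in>{snd u + b..<snd v + b}. agree R' m' n' \<and> agree R' (Suc m') (Suc n')"
    if m': "m' \<in> {fst u + a..<fst v + a}" for m'
  proof -
    obtain m where m: "m' = m + a" "m \<in> {fst u..<fst v}"
      using m' by (intro that[of "m' - a"]) auto
    obtain n where n: "n \<in> {snd u..<snd v}" "agree R m n" "agree R (Suc m) (Suc n)"
      using 0(1) m(2) unfolding similar.simps by blast
    show ?thesis
      using ag[OF n(2)] ag[OF n(3)] m n(1) by (intro bexI[of _ "n + b"]) auto
  qed
  have 2: "\<exists>m'\<in>{fst u + a..<fst v + a}. agree R' m' n' \<and> agree R' (Suc m') (Suc n')"
    if n': "n' \<in> {snd u + b..<snd v + b}" for n'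
  proof -
    obtain n where n: "n' = n + b" "n \<in> {snd u..<snd v}"
      using n' by (intro that[of "n' - b"]) auto
    obtain m where m: "m \<in> {fst u..<fst v}" "agree R m n" "agree R (Suc m) (Suc n)"
      using 0(1) n(2) unfolding similar.simps by blast
    show ?thesis
      using ag[OF m(2)] ag[OF m(3)] n m(1) by (intro bexI[of _ "m + a"]) auto
  qed
  show ?case
    using 0 1 2 ag by auto
next
  case (Suc k)
  have ext: "similar k (insert (X', Y') R') (fst u + a, snd u + b) (fst v + a, snd v + b)"
    if XY: "similar k (insert (X, Y) R) u v" "\<And>n. n + a \<in> X' \<longleftrightarrow> n \<in> X" "\<And>n. n + b \<in> Y' \<longleftrightarrow> n \<in> Y"
    for X Y X' Y'
  proof (rule Suc.IH[OF XY(1) _ Suc.prems(3,4)])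
    fix A' B'
    assume "(A', B') \<in> insert (X', Y') R'"
    then consider "A' = X'" "B' = Y'" | "(A', B') \<in> R'"
      by blast
    then show "\<exists>(A, B)\<in>insert (X, Y) R.
        (\<forall>n\<in>{fst u..fst v}. n + a \<in> A' \<longleftrightarrow> n \<in> A) \<and> (\<forall>n\<in>{snd u..snd v}. n + b \<in> B' \<longleftrightarrow> n \<in> B)"
    proof cases
      case 1
      then show ?thesis
        using XY(2,3) by (intro bexI[of _ "(X, Y)"]) simp_all
    next
      case 2
      then show ?thesis
        using Suc.prems(2) by (meson insertI2)
    qed
  qed
  have 1: "\<exists>Y'. similar k (insert (X', Y') R') (fst u + a, snd u + b) (fst v + a, snd v + b)" for X'
  proof -
    \<comment> \<open>The move is pulled back along the translation and the answer pushed
      forward.\<close>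
    obtain Y where Y: "similar k (insert ({n. n + a \<in> X'}, Y) R) u v"
      using Suc.prems(1) by auto
    show ?thesis
      by (intro exI[of _ "(\<lambda>n. n + b) ` Y"] ext[OF Y]) auto
  qed
  have 2: "\<exists>X'. similar k (insert (X', Y') R') (fst u + a, snd u + b) (fst v + a, snd v + b)" for Y'
  proof -
    obtain X where X: "similar k (insert (X, {n. n + b \<in> Y'}) R) u v"
      using Suc.prems(1) by auto
    show ?thesis
      by (intro exI[of _ "(\<lambda>n. n + a) ` X"] ext[OF X]) auto
  qed
  show ?case
    using 1 2 by simp
qed

lemma similar_cong:
  assumes "similar k R u v" "fst u \<le> fst v" "snd u \<le> snd v"
    and "\<And>A' B'. (A', B') \<in> R' \<Longrightarrow> \<exists>(A, B)\<in>R.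
           (\<forall>n\<in>{fst u..fst v}. n \<in> A' \<longleftrightarrow> n \<in> A) \<and> (\<forall>n\<in>{snd u..snd v}. n \<in> B' \<longleftrightarrow> n \<in> B)"
  shows "similar k R' u v"
  using similar_translate[of k R u v R' 0 0] assms by simp

lemma similar_insert_cong:
  assumes "similar k (insert (X, Y) R) u v" "fst u \<le> fst v" "snd u \<le> snd v"
    and "\<And>n. n \<in> {fst u..fst v} \<Longrightarrow> n \<in> X' \<longleftrightarrow> n \<in> X"
    and "\<And>n. n \<in> {snd u..snd v} \<Longrightarrow> n \<in> Y' \<longleftrightarrow> n \<in> Y"
  shows "similar k (insert (X', Y') R) u v"
proof (rule similar_cong[OF assms(1-3)])
  fix A' B'
  assume "(A', B') \<in> insert (X', Y') R"
  then consider "A' = X'" "B' = Y'" | "(A', B') \<in> R"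
    by blast
  then show "\<exists>(A, B)\<in>insert (X, Y) R.
      (\<forall>n\<in>{fst u..fst v}. n \<in> A' \<longleftrightarrow> n \<in> A) \<and> (\<forall>n\<in>{snd u..snd v}. n \<in> B' \<longleftrightarrow> n \<in> B)"
  proof cases
    case 1
    then show ?thesis
      using assms(4,5) by (intro bexI[of _ "(X, Y)"]) simp_all
  next
    case 2
    then show ?thesis
      by (intro bexI[of _ "(A', B')"]) simp_all
  qed
qed

lemma similar_subset:
  assumes "similar k R u v" "fst u \<le> fst v" "snd u \<le> snd v" "R' \<subseteq> R"
  shows "similar k R' u v"
  by (rule similar_cong[OF assms(1-3)]) (use assms(4) in blast)

text \<open>A round can be wasted on the empty set, after which the answer is forgotten.\<close>

lemma similar_Suc:
  assumes "similar (Suc k) R u v" "fst u \<le> fst v" "snd u \<le> snd v"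
  shows "similar k R u v"
proof -
  obtain Y where "similar k (insert ({}, Y) R) u v"
    using assms(1) by auto
  then show ?thesis
    by (rule similar_subset) (use assms in auto)
qed

lemma similar_level_mono:
  assumes "similar k R u v" "l \<le> k" "fst u \<le> fst v" "snd u \<le> snd v"
  shows "similar l R u v"
  using assms(2,1) by (induction rule: inc_induct) (use assms(3,4) similar_Suc in blast)+

text \<open>Forgetting all rounds leaves the endpoint clauses of the game of length 0. They force
  answers found on adjacent intervals to agree at the common point.\<close>

lemma similar_ends:
  assumes "similar k R u v" "fst u \<le> fst v" "snd u \<le> snd v" "(A, B) \<in> R"
  shows "fst u \<in> A \<longleftrightarrow> snd u \<in> B" "fst v \<in> A \<longleftrightarrow> snd v \<in> B"
  using similar_level_mono[OF assms(1) _ assms(2,3), of 0] assms(4) by (auto simp: agree_def)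

lemma similar_swap:
  "similar k R u v \<Longrightarrow> similar k (R\<inverse>) (prod.swap u) (prod.swap v)"
proof (induction k arbitrary: R)
  case 0
  have "agree (R\<inverse>) n m" if "agree R m n" for m n
    using that by (auto simp: agree_def)
  then show ?case
    using 0 by fastforce
next
  case (Suc k)
  have "(insert (X, Y) R)\<inverse> = insert (Y, X) (R\<inverse>)" for X Y :: "nat set"
    by auto
  then show ?case
    using Suc by (metis similar.simps(2))
qed

text \<open>Concatenation of intervals: a move is answered separately on the two pieces and the
  answers are glued at the cut \<open>v\<close>.\<close>

lemma similar_trans:
  assumes "similar k R u v" "similar k R v w"
    and "fst u \<le> fst v" "snd u \<le> snd v" "fst v \<le> fst w" "snd v \<le> snd w"
  shows "similar k R u w"
  using assms
proof (induction k arbitrary: R)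
  case 0
  have 1: "\<exists>n\<in>{snd u..<snd w}. agree R m n \<and> agree R (Suc m) (Suc n)"
    if m: "m \<in> {fst u..<fst w}" for m
  proof (cases "m < fst v")
    case True
    then have "m \<in> {fst u..<fst v}"
      using m by simp
    then obtain n where "n \<in> {snd u..<snd v}" "agree R m n \<and> agree R (Suc m) (Suc n)"
      using 0(1) unfolding similar.simps by blast
    then show ?thesis
      using 0(6) by (intro bexI[of _ n]) simp_all
  next
    case False
    then have "m \<in> {fst v..<fst w}"
      using m by simp
    then obtain n where "n \<in> {snd v..<snd w}" "agree R m n \<and> agree R (Suc m) (Suc n)"
      using 0(2) unfolding similar.simps by blast
    then show ?thesis
      using 0(4) by (intro bexI[of _ n]) simp_all
  qed
  have 2: "\<exists>m\<in>{fst u..<fst w}. agree R m n \<and> agree R (Suc m) (Suc n)"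
    if n: "n \<in> {snd u..<snd w}" for n
  proof (cases "n < snd v")
    case True
    then have "n \<in> {snd u..<snd v}"
      using n by simp
    then obtain m where "m \<in> {fst u..<fst v}" "agree R m n \<and> agree R (Suc m) (Suc n)"
      using 0(1) unfolding similar.simps by blast
    then show ?thesis
      using 0(5) by (intro bexI[of _ m]) simp_all
  next
    case False
    then have "n \<in> {snd v..<snd w}"
      using n by simp
    then obtain m where "m \<in> {fst v..<fst w}" "agree R m n \<and> agree R (Suc m) (Suc n)"
      using 0(2) unfolding similar.simps by blast
    then show ?thesis
      using 0(3) by (intro bexI[of _ m]) simp_all
  qed
  show ?case
    using 0(1,2) 1 2 by simp
next
  case (Suc k)
  have 1: "\<exists>Y. similar k (insert (X, Y) R) u w" for X
  proof -
    obtain Y1 Y2 where Y: "similar k (insert (X, Y1) R) u v" "similar k (insert (X, Y2) R) v w"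
      using Suc.prems by (meson similar.simps(2))
    \<comment> \<open>Each answer contains \<open>snd v\<close> exactly if \<open>X\<close> contains
      \<open>fst v\<close>.\<close>
    have v: "snd v \<in> Y1 \<longleftrightarrow> snd v \<in> Y2"
      using similar_ends(2)[OF Y(1), of X Y1] similar_ends(1)[OF Y(2), of X Y2] Suc.prems by auto
    \<comment> \<open>\<open>Y2\<close> decides the cut itself; by \<open>v\<close> this does not
      disturb the left piece.\<close>
    define Y where "Y = {n. if n < snd v then n \<in> Y1 else n \<in> Y2}"
    have "similar k (insert (X, Y) R) u v"
      by (rule similar_insert_cong[OF Y(1) Suc.prems(3,4)])
        (use v in \<open>auto simp: Y_def dest: le_neq_implies_less\<close>)
    moreover have "similar k (insert (X, Y) R) v w"
      by (rule similar_insert_cong[OF Y(2) Suc.prems(5,6)]) (auto simp: Y_def)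
    ultimately show ?thesis
      using Suc.IH Suc.prems by blast
  qed
  have 2: "\<exists>X. similar k (insert (X, Y) R) u w" for Y
  proof -
    obtain X1 X2 where X: "similar k (insert (X1, Y) R) u v" "similar k (insert (X2, Y) R) v w"
      using Suc.prems by (meson similar.simps(2))
    have v: "fst v \<in> X1 \<longleftrightarrow> fst v \<in> X2"
      using similar_ends(2)[OF X(1), of X1 Y] similar_ends(1)[OF X(2), of X2 Y] Suc.prems by auto
    define X where "X = {n. if n < fst v then n \<in> X1 else n \<in> X2}"
    have "similar k (insert (X, Y) R) u v"
      by (rule similar_insert_cong[OF X(1) Suc.prems(3,4)])
        (use v in \<open>auto simp: X_def dest: le_neq_implies_less\<close>)
    moreover have "similar k (insert (X, Y) R) v w"
      by (rule similar_insert_cong[OF X(2) Suc.prems(5,6)]) (auto simp: X_def)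
    ultimately show ?thesis
      using Suc.IH Suc.prems by blast
  qed
  show ?case
    using 1 2 by simp
qed

section \<open>Finitely many types of intervals\<close>

text \<open>Recoding colours as naturals keeps their type fixed, as the induction on the game length
  in \<open>similar_finite_index\<close> requires.\<close>

lemma finite_colouring_nat:
  fixes g :: "'a \<Rightarrow> 'b"
  assumes "finite (g ` S)"
  obtains c :: "'a \<Rightarrow> nat" where "finite (c ` S)"
    and "\<And>s t. s \<in> S \<Longrightarrow> t \<in> S \<Longrightarrow> c s = c t \<Longrightarrow> g s = g t"
proof -
  obtain h :: "'b \<Rightarrow> nat" where h: "inj_on h (g ` S)"
    using finite_imp_inj_to_nat_seg[OF assms] by auto
  show thesis
  proof (rule that[of "h \<circ> g"])
    show "finite ((h \<circ> g) ` S)"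
      using finite_imageI[OF assms, of h] by (simp add: image_image)
    show "g s = g t" if "s \<in> S" "t \<in> S" "(h \<circ> g) s = (h \<circ> g) t" for s t
      using that h by (auto dest: inj_onD)
  qed
qed

text \<open>The colour \<open>c\<close> is the type of an interval for the game of length \<open>k\<close>.\<close>
lemma similar_finite_index:
  "\<exists>c :: nat set list \<times> nat \<times> nat \<Rightarrow> nat. finite (c ` {s. length (fst s) = l}) \<and>
     (\<forall>As Bs p p' q q'. length As = l \<longrightarrow> length Bs = l \<longrightarrow>
        c (As, p, p') = c (Bs, q, q') \<longrightarrow> similar k (set (zip As Bs)) (p, q) (p', q'))"
proof (induction k arbitrary: l)
  case 0
  define pat :: "nat set list \<Rightarrow> nat \<Rightarrow> bool list" where "pat As n = map (\<lambda>A. n \<in> A) As" for As n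
  \<comment> \<open>This records what the game of length 0 tests: the traces at both ends and the
    set of traces at successive points.\<close>
  define g where "g s = (case s of (As, p, p') \<Rightarrow>
      (pat As p, pat As p', (\<lambda>n. (pat As n, pat As (Suc n))) ` {p..<p'}))" for s
  define L where "L = {xs :: bool list. length xs = l}"
  have fin: "finite L"
    using finite_lists_length_eq[of "UNIV :: bool set" l] by (simp add: L_def)
  have "g ` {s. length (fst s) = l} \<subseteq> L \<times> L \<times> Pow (L \<times> L)"
    by (auto simp: g_def L_def pat_def)
  then have "finite (g ` {s. length (fst s) = l})"
    by (rule finite_subset) (use fin in simp)
  then obtain c :: "nat set list \<times> nat \<times> nat \<Rightarrow> nat" where c: "finite (c ` {s. length (fst s) = l})"
    "\<And>s t. s \<in> {s. length (fst s) = l} \<Longrightarrow> t \<in> {s. length (fst s) = l} \<Longrightarrow> c s = c t \<Longrightarrow> g s = g t"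
    using finite_colouring_nat by blast
  show ?case
  proof (intro exI[of _ c] conjI allI impI c(1))
    fix As Bs p p' q q'
    assume len: "length As = l" "length Bs = l" and "c (As, p, p') = c (Bs, q, q')"
    then have g: "g (As, p, p') = g (Bs, q, q')"
      using c(2) by simp
    have ag: "agree (set (zip As Bs)) m n \<longleftrightarrow> pat As m = pat Bs n" for m n
      using len by (auto simp: agree_def pat_def set_zip list_eq_iff_nth_eq)
    have im: "(\<lambda>n. (pat As n, pat As (Suc n))) ` {p..<p'} =
        (\<lambda>n. (pat Bs n, pat Bs (Suc n))) ` {q..<q'}" (is "?f ` _ = ?h ` _")
      using g by (simp add: g_def)
    have "\<exists>n\<in>{q..<q'}. ?f m = ?h n" if "m \<in> {p..<p'}" for m
      using im that by (metis (no_types, lifting) imageE imageI)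
    moreover have "\<exists>m\<in>{p..<p'}. ?f m = ?h n" if "n \<in> {q..<q'}" for n
      using im that by (metis (no_types, lifting) imageE imageI)
    ultimately show "similar 0 (set (zip As Bs)) (p, q) (p', q')"
      using g by (simp add: ag g_def)
  qed
next
  case (Suc k)
  obtain c :: "nat set list \<times> nat \<times> nat \<Rightarrow> nat"
    where c: "finite (c ` {s. length (fst s) = Suc l})"
      "\<And>As Bs p p' q q'. length As = Suc l \<Longrightarrow> length Bs = Suc l \<Longrightarrow>
         c (As, p, p') = c (Bs, q, q') \<Longrightarrow> similar k (set (zip As Bs)) (p, q) (p', q')"
    using Suc.IH[of "Suc l"] by blast
  \<comment> \<open>The type for \<open>Suc k\<close> rounds is the set of types for
    \<open>k\<close> rounds that one more set can produce, a subset of a finite set. Equal ranges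
    answer a move on either side.\<close>
  define g where "g s = (case s of (As, p, p') \<Rightarrow> range (\<lambda>X. c (X # As, p, p')))" for s
  have "g ` {s. length (fst s) = l} \<subseteq> Pow (c ` {s. length (fst s) = Suc l})"
    by (auto simp: g_def)
  then have "finite (g ` {s. length (fst s) = l})"
    by (rule finite_subset) (use c(1) in simp)
  then obtain d :: "nat set list \<times> nat \<times> nat \<Rightarrow> nat" where d: "finite (d ` {s. length (fst s) = l})"
    "\<And>s t. s \<in> {s. length (fst s) = l} \<Longrightarrow> t \<in> {s. length (fst s) = l} \<Longrightarrow> d s = d t \<Longrightarrow> g s = g t"
    using finite_colouring_nat by blast
  show ?case
  proof (intro exI[of _ d] conjI allI impI d(1))
    fix As Bs p p' q q'
    assume len: "length As = l" "length Bs = l" and "d (As, p, p') = d (Bs, q, q')"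
    then have g: "range (\<lambda>X. c (X # As, p, p')) = range (\<lambda>X. c (X # Bs, q, q'))"
      using d(2)[of "(As, p, p')" "(Bs, q, q')"] by (simp add: g_def)
    have "similar k (insert (X, Y) (set (zip As Bs))) (p, q) (p', q')"
      if "c (X # As, p, p') = c (Y # Bs, q, q')" for X Y
      using c(2)[OF _ _ that] len by simp
    moreover have "\<exists>Y. c (X # As, p, p') = c (Y # Bs, q, q')" for X
      using g by (metis (no_types, lifting) rangeE rangeI)
    moreover have "\<exists>X. c (X # As, p, p') = c (Y # Bs, q, q')" for Y
      using g by (metis (no_types, lifting) rangeE rangeI)
    ultimately show "similar (Suc k) (set (zip As Bs)) (p, q) (p', q')"
      unfolding similar.simps by meson
  qed
qed

text \<open>By the pigeonhole principle infinitely many lengths \<open>L\<close> give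
  \<open>[0, L]\<close>, marked at its ends, the same type. One takes \<open>L\<close> large, then
  \<open>L'\<close> larger still, and translates to \<open>p\<close> and \<open>q\<close>.\<close>

lemma similar_spaced_intervals:
  obtains p' q' where "similar k {({p, p'}, {q, q'})} (p, q) (p', q')" "q + N < p'" "p' + N < q'"
proof -
  obtain c :: "nat set list \<times> nat \<times> nat \<Rightarrow> nat"
    where c: "finite (c ` {s. length (fst s) = 1})"
      "\<And>As Bs p p' q q'. length As = 1 \<Longrightarrow> length Bs = 1 \<Longrightarrow>
         c (As, p, p') = c (Bs, q, q') \<Longrightarrow> similar k (set (zip As Bs)) (p, q) (p', q')"
    using similar_finite_index[of 1 k] by blast
  define g where "g L = c ([{0, L}], 0, L)" for L
  have "finite (g ` UNIV)"
    by (rule finite_subset[OF _ c(1)]) (auto simp: g_def)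
  then obtain L0 where inf: "infinite {L. g L = g L0}"
    using pigeonhole_infinite[of "UNIV :: nat set" g] by auto
  obtain L where L: "q + N < L" "g L = g L0"
    using inf by (metis (mono_tags, lifting) infinite_nat_iff_unbounded mem_Collect_eq)
  obtain L' where L': "p + L + N < L'" "g L' = g L0"
    using inf by (metis (mono_tags, lifting) infinite_nat_iff_unbounded mem_Collect_eq)
  have "similar k {({0, L}, {0, L'})} (0, 0) (L, L')"
    using c(2)[of "[{0, L}]" "[{0, L'}]" 0 L 0 L'] L L' by (simp add: g_def)
  then have "similar k {({p, p + L}, {q, q + L'})} (p, q) (p + L, q + L')"
    using similar_translate[of k "{({0, L}, {0, L'})}" "(0, 0)" "(L, L')"
        "{({p, p + L}, {q, q + L'})}" p q] by (simp add: add.commute)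
  then show thesis
    by (rule that) (use L L' in auto)
qed

section \<open>Stages and their countable chains\<close>

type_synonym stage = "(nat set \<times> nat set) set \<times> (nat \<times> nat) set"

text \<open>A stage consists of the pairs of sets already matched and of the set of cut pairs.\<close>
definition good :: "stage \<Rightarrow> bool" where
  "good s \<longleftrightarrow> countable (fst s) \<and> infinite (snd s) \<and>
     (\<forall>u\<in>snd s. \<forall>v\<in>snd s. fst u < fst v \<longleftrightarrow> snd u < snd v) \<and>
     (\<forall>k R. finite R \<longrightarrow> R \<subseteq> fst s \<longrightarrow>
        (\<exists>F. finite F \<and> (\<forall>u\<in>snd s - F. \<forall>v\<in>snd s - F. fst u < fst v \<longrightarrow> similar k R u v)))"

text \<open>\<open>t\<close> is the later stage. Its cut pairs lie among those of \<open>s\<close>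
  only up to a finite set, because at countable limits only a pseudo-intersection is
  available.\<close>

definition below :: "stage \<Rightarrow> stage \<Rightarrow> bool" where
  "below s t \<longleftrightarrow> fst s \<subseteq> fst t \<and> finite (snd t - snd s)"

lemma below_refl: "below s s"
  by (simp add: below_def)

lemma below_trans:
  assumes "below s t" "below t r"
  shows "below s r"
proof -
  have "snd r - snd s \<subseteq> (snd r - snd t) \<union> (snd t - snd s)"
    by blast
  then show ?thesis
    using assms unfolding below_def by (meson finite_UnI finite_subset subset_trans)
qed

lemma good_similar:
  assumes "good s" "finite R" "R \<subseteq> fst s"
  obtains F where "finite F"
    "\<And>u v. u \<in> snd s - F \<Longrightarrow> v \<in> snd s - F \<Longrightarrow> fst u < fst v \<Longrightarrow> similar k R u v"
  using assms unfolding good_def by metis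

lemma good_order:
  assumes "good s" "u \<in> snd s" "v \<in> snd s"
  shows "fst u < fst v \<longleftrightarrow> snd u < snd v"
  using assms by (auto simp: good_def)

text \<open>The game and the order clause are symmetric, so domain and range may be
  exchanged.\<close>

lemma good_swap:
  assumes "good (f, P)"
  shows "good (f\<inverse>, P\<inverse>)"
proof -
  have inv: "f\<inverse> = prod.swap ` f" "P\<inverse> = prod.swap ` P"
    by force+
  have "\<exists>F. finite F \<and> (\<forall>u\<in>P\<inverse> - F. \<forall>v\<in>P\<inverse> - F. fst u < fst v \<longrightarrow> similar k R u v)"
    if R: "finite R" "R \<subseteq> f\<inverse>" for k R
  proof -
    have "R\<inverse> \<subseteq> f"
      using R(2) by auto
    then obtain F where F: "finite F"
      "\<And>u v. u \<in> P - F \<Longrightarrow> v \<in> P - F \<Longrightarrow> fst u < fst v \<Longrightarrow> similar k (R\<inverse>) u v"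
      using good_similar[OF assms, of "R\<inverse>" k] R(1) by auto
    show ?thesis
    proof (intro exI[of _ "F\<inverse>"] conjI ballI impI)
      fix u v
      assume uv: "u \<in> P\<inverse> - F\<inverse>" "v \<in> P\<inverse> - F\<inverse>" "fst u < fst v"
      \<comment> \<open>The order clause passes from one coordinate of the cut pairs to the
        other.\<close>
      then have "similar k (R\<inverse>) (prod.swap u) (prod.swap v)"
        using good_order[OF assms, of "prod.swap u" "prod.swap v"]
        by (intro F(2)) auto
      then show "similar k R u v"
        using similar_swap by fastforce
    qed (use F(1) in simp)
  qed
  then show ?thesis
    using assms unfolding good_def by (auto simp: inv finite_image_iff)
qed

text \<open>The order clause makes \<open>fst\<close> injective on \<open>P\<close>, so each
  \<open>Q i\<close> has members with arbitrarily large \<open>fst\<close>; \<open>snd\<close> then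
  increases along. Varying \<open>Q i\<close> gives diagonal sequences.\<close>

lemma increasing_selection:
  fixes P :: "(nat \<times> nat) set"
  assumes chain: "\<And>u v. u \<in> P \<Longrightarrow> v \<in> P \<Longrightarrow> fst u < fst v \<longleftrightarrow> snd u < snd v"
    and Q: "\<And>i :: nat. infinite (Q i)" "\<And>i. Q i \<subseteq> P"
  obtains u where "\<And>i. u i \<in> Q i" "strict_mono (fst \<circ> u)" "strict_mono (snd \<circ> u)"
proof -
  have "inj_on fst P"
    using chain by (intro inj_onI prod_eqI) (auto, metis linorder_neq_iff)
  then have "infinite (fst ` Q i)" for i
    using Q by (metis finite_image_iff inj_on_subset)
  then have ex: "\<exists>v\<in>Q i. n < fst v" for i n
    by (auto simp: infinite_nat_iff_unbounded)
  have "\<exists>u. \<forall>i. u i \<in> Q i \<and> fst (u i) < fst (u (Suc i))"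
    using ex by (intro dependent_nat_choice) blast+
  then obtain u where u: "\<And>i. u i \<in> Q i" "\<And>i. fst (u i) < fst (u (Suc i))"
    by blast
  then have "snd (u i) < snd (u (Suc i))" for i
    using chain[of "u i" "u (Suc i)"] Q(2) by blast
  then show thesis
    using u by (intro that[of u]) (auto simp: strict_mono_Suc_iff)
qed

lemma strict_mono_enum_infinite:
  fixes u :: "nat \<Rightarrow> nat \<times> nat"
  assumes "strict_mono (fst \<circ> u)"
  shows "infinite (range u)" "finite F \<Longrightarrow> \<exists>N. \<forall>i\<ge>N. u i \<notin> F"
proof -
  have inj: "inj u"
    using strict_mono_imp_inj_on[OF assms] by (rule inj_on_imageI2)
  then show "infinite (range u)"
    by (simp add: finite_image_iff)
  assume "finite F"
  then have "finite (u -` F)"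
    using inj by (rule finite_vimageI)
  then obtain N where "\<forall>i\<in>u -` F. i < N"
    by (meson finite_nat_set_iff_bounded)
  then show "\<exists>N. \<forall>i\<ge>N. u i \<notin> F"
    by (intro exI[of _ N]) (metis linorder_not_le vimageI)
qed

lemma finite_chain_greatest:
  assumes "finite S" "S \<noteq> {}" "\<And>s t. s \<in> S \<Longrightarrow> t \<in> S \<Longrightarrow> below s t \<or> below t s"
  shows "\<exists>t\<in>S. \<forall>s\<in>S. below s t"
  using assms
proof (induction rule: finite_ne_induct)
  case (singleton x)
  then show ?case
    by (simp add: below_refl)
next
  case (insert x S)
  then obtain t where t: "t \<in> S" "\<forall>s\<in>S. below s t"
    by auto
  have "below x t \<or> below t x"
    using insert.prems t(1) by blast
  then show ?case
    using t below_refl below_trans by (metis insert_iff)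
qed

lemma finite_subset_chain_union:
  assumes "finite R" "R \<subseteq> (\<Union>s\<in>S. fst s)" "S \<noteq> {}"
    and "\<And>s t. s \<in> S \<Longrightarrow> t \<in> S \<Longrightarrow> fst s \<subseteq> fst t \<or> fst t \<subseteq> fst s"
  shows "\<exists>s\<in>S. R \<subseteq> fst s"
  using assms(1,2)
proof (induction rule: finite_induct)
  case empty
  then show ?case
    using assms(3) by auto
next
  case (insert x R)
  then obtain s s' where s: "s \<in> S" "R \<subseteq> fst s" "s' \<in> S" "x \<in> fst s'"
    by auto
  then show ?case
    using assms(4)[OF s(1,3)] by blast
qed

text \<open>The matched pairs are united and the cut sets diagonalised: a finite \<open>R\<close>
  already sits inside one stage \<open>s\<close>, and the new cuts lie in the cuts of
  \<open>s\<close> from some index on.\<close>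

lemma chain_upper_bound:
  assumes "countable S" "S \<noteq> {}" and good: "\<And>s. s \<in> S \<Longrightarrow> good s"
    and chain: "\<And>s t. s \<in> S \<Longrightarrow> t \<in> S \<Longrightarrow> below s t \<or> below t s"
  shows "\<exists>t. good t \<and> (\<forall>s\<in>S. below s t)"
proof -
  define e where "e = from_nat_into S"
  have e: "range e = S"
    using assms(1,2) by (simp add: e_def)
  then have good_e: "good (e i)" for i
    using good by blast
  \<comment> \<open>The enumeration need not follow the order of the chain, hence intersections over
    initial segments. They are infinite because finitely many stages have a greatest one,
    \<open>e j\<close>, whose cut set is almost contained in the others.\<close>
  define Q where "Q i = (\<Inter>j\<le>i. snd (e j))" for i
  have "infinite (Q i)" for i
  proof -
    have "\<exists>t\<in>e ` {..i}. \<forall>s\<in>e ` {..i}. below s t"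
      by (rule finite_chain_greatest) (use chain e in blast)+
    then obtain j where j: "\<And>l. l \<le> i \<Longrightarrow> below (e l) (e j)"
      by auto
    have "finite (\<Union>l\<le>i. snd (e j) - snd (e l))"
      using j by (intro finite_UN_I) (simp_all add: below_def)
    moreover have "infinite (snd (e j))"
      using good_e by (simp add: good_def)
    ultimately have "infinite (snd (e j) - (\<Union>l\<le>i. snd (e j) - snd (e l)))"
      by (rule Diff_infinite_finite)
    moreover have "snd (e j) - (\<Union>l\<le>i. snd (e j) - snd (e l)) \<subseteq> Q i"
      by (auto simp: Q_def)
    ultimately show ?thesis
      using finite_subset by blast
  qed
  moreover have "fst u < fst v \<longleftrightarrow> snd u < snd v" if "u \<in> snd (e 0)" "v \<in> snd (e 0)" for u v
    using good_order[OF good_e that] .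
  moreover have "Q i \<subseteq> snd (e 0)" for i
    by (auto simp: Q_def)
  ultimately obtain u where u: "\<And>i. u i \<in> Q i" "strict_mono (fst \<circ> u)" "strict_mono (snd \<circ> u)"
    using increasing_selection[of "snd (e 0)" Q] by blast
  define t where "t = (\<Union> (fst ` S), range u)"
  have almost: "finite (range u - snd (e j))" for j
  proof (rule finite_subset)
    show "range u - snd (e j) \<subseteq> u ` {..<j}"
    proof
      fix x assume "x \<in> range u - snd (e j)"
      then obtain i where i: "x = u i" "u i \<notin> snd (e j)"
        by auto
      then have "\<not> j \<le> i"
        using u(1)[of i] by (auto simp: Q_def)
      then show "x \<in> u ` {..<j}"
        using i by auto
    qed
  qed simp
  have below: "below s t" if "s \<in> S" for s
  proof -
    obtain j where "s = e j"
      using e \<open>s \<in> S\<close> by blast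
    then show ?thesis
      using almost \<open>s \<in> S\<close> by (auto simp: below_def t_def)
  qed
  have "good t"
    unfolding good_def
  proof (intro conjI allI impI)
    show "countable (fst t)"
      using assms(1) good by (auto simp: t_def good_def)
    show "infinite (snd t)"
      using strict_mono_enum_infinite(1)[OF u(2)] by (simp add: t_def)
    show "\<forall>x\<in>snd t. \<forall>y\<in>snd t. fst x < fst y \<longleftrightarrow> snd x < snd y"
      using strict_mono_less[OF u(2)] strict_mono_less[OF u(3)] by (auto simp: t_def)
    fix k R
    assume R: "finite R" "R \<subseteq> fst t"
    have "\<exists>s\<in>S. R \<subseteq> fst s"
      by (rule finite_subset_chain_union[OF R(1)])
        (use R(2) assms(2) chain in \<open>unfold below_def t_def fst_conv, blast+\<close>)
    then obtain s where s: "s \<in> S" "R \<subseteq> fst s"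
      by blast
    obtain F where F: "finite F"
      "\<And>u v. u \<in> snd s - F \<Longrightarrow> v \<in> snd s - F \<Longrightarrow> fst u < fst v \<Longrightarrow> similar k R u v"
      using good_similar[OF good[OF s(1)] R(1) s(2)] by blast
    \<comment> \<open>Dropped are the exceptions of \<open>s\<close> and the finitely many cuts
      outside \<open>snd s\<close>.\<close>
    show "\<exists>F. finite F \<and> (\<forall>u\<in>snd t - F. \<forall>v\<in>snd t - F. fst u < fst v \<longrightarrow> similar k R u v)"
      by (rule exI[of _ "F \<union> (snd t - snd s)"]) (use F below[OF s(1)] in \<open>auto simp: below_def\<close>)
  qed
  then show ?thesis
    using below by blast
qed

section \<open>Adding one set to the domain or the range\<close>

lemma countable_increasing_union:
  assumes "countable f"
  obtains R :: "nat \<Rightarrow> 'a set" where "\<And>i. finite (R i)" "\<And>i. R i \<subseteq> f"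
    "\<And>S. finite S \<Longrightarrow> S \<subseteq> f \<Longrightarrow> \<exists>i. \<forall>j\<ge>i. S \<subseteq> R j"
proof -
  define R where "R i = {x \<in> f. to_nat_on f x < i}" for i
  have inj: "inj_on (to_nat_on f) f"
    using assms by (rule inj_on_to_nat_on)
  show thesis
  proof (rule that[of R])
    show "finite (R i)" for i
    proof (rule inj_on_finite)
      show "inj_on (to_nat_on f) (R i)"
        by (rule inj_on_subset[OF inj]) (auto simp: R_def)
      show "to_nat_on f ` R i \<subseteq> {..<i}"
        by (auto simp: R_def)
    qed simp
    show "R i \<subseteq> f" for i
      by (auto simp: R_def)
    show "\<exists>i. \<forall>j\<ge>i. S \<subseteq> R j" if S: "finite S" "S \<subseteq> f" for S
    proof -
      obtain i where "\<forall>x\<in>to_nat_on f ` S. x < i"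
        using S(1) by (meson finite_imageI finite_nat_set_iff_bounded)
      then show ?thesis
        using S(2) by (intro exI[of _ i]) (force simp: R_def)
    qed
  qed
qed

lemma similar_sequence:
  assumes mono: "strict_mono (fst \<circ> u)" "strict_mono (snd \<circ> u)"
    and step: "\<And>i. N \<le> i \<Longrightarrow> similar k R (u i) (u (Suc i))"
    and "N \<le> i" "i < j"
  shows "similar k R (u i) (u j)"
proof -
  have le: "fst (u a) \<le> fst (u b)" "snd (u a) \<le> snd (u b)" if "a \<le> b" for a b
    using that mono[THEN strict_mono_mono, THEN monoD, of a b] by simp_all
  have "Suc i \<le> j"
    using \<open>i < j\<close> by simp
  then show ?thesis
  proof (induction j rule: dec_induct)
    case base
    show ?case
      by (rule assms(3)[OF \<open>N \<le> i\<close>])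
  next
    case (step j)
    then have "N \<le> j"
      using \<open>N \<le> i\<close> by simp
    show ?case
      by (rule similar_trans[OF step.IH assms(3)[OF \<open>N \<le> j\<close>]]) (use step.hyps in \<open>simp_all add: le\<close>)
  qed
qed

lemma strict_mono_step_index:
  fixes g :: "nat \<Rightarrow> nat"
  assumes "strict_mono g" "g i \<le> n" "n < g (Suc i)"
  shows "(LEAST j. n < g (Suc j)) = i"
proof (rule Least_equality)
  show "n < g (Suc i)"
    by (fact assms(3))
  fix j
  assume "n < g (Suc j)"
  then have "g i < g (Suc j)"
    using assms(2) by simp
  then show "i \<le> j"
    using strict_mono_less[OF assms(1)] by simp
qed

text \<open>Cuts are thinned so that the \<open>i\<close>-th interval is won with
  \<open>Suc i\<close> rounds over the finite part \<open>R i\<close>. Spending one round on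
  \<open>X\<close> leaves \<open>i\<close> rounds, so every game length and every finite part are
  still covered from some index on.\<close>

lemma good_extend_domain:
  assumes "good s"
  obtains t Y where "good t" "below s t" "(X, Y) \<in> fst t"
proof -
  obtain f P where s: "s = (f, P)"
    by (cases s)
  have "countable f"
    using assms by (simp add: good_def s)
  then obtain R where R: "\<And>i :: nat. finite (R i)" "\<And>i. R i \<subseteq> f"
    "\<And>S. finite S \<Longrightarrow> S \<subseteq> f \<Longrightarrow> \<exists>i. \<forall>j\<ge>i. S \<subseteq> R j"
    using countable_increasing_union by blast
  have "\<exists>F. finite F \<and> (\<forall>u\<in>P - F. \<forall>v\<in>P - F. fst u < fst v \<longrightarrow> similar (Suc i) (R i) u v)" for i
    using good_similar[OF assms R(1)[of i], of "Suc i"] R(2)[of i] by (metis s fst_conv snd_conv)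
  then obtain F where F: "\<And>i. finite (F i)"
    "\<And>i u v. u \<in> P - F i \<Longrightarrow> v \<in> P - F i \<Longrightarrow> fst u < fst v \<Longrightarrow> similar (Suc i) (R i) u v"
    by metis
  \<comment> \<open>Excluding \<open>F j\<close> for all \<open>j \<le> i\<close> keeps both
    \<open>u i\<close> and \<open>u (Suc i)\<close> outside \<open>F i\<close>.\<close>
  have "infinite (P - (\<Union>j\<le>i. F j))" for i
    by (rule Diff_infinite_finite) (use F(1) assms in \<open>auto simp: good_def s\<close>)
  moreover have "fst u < fst v \<longleftrightarrow> snd u < snd v" if "u \<in> P" "v \<in> P" for u v
    using good_order[OF assms] that by (simp add: s)
  ultimately obtain u where u: "\<And>i. u i \<in> P - (\<Union>j\<le>i. F j)"
    and mono: "strict_mono (fst \<circ> u)" "strict_mono (snd \<circ> u)"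
    using increasing_selection[of P "\<lambda>i. P - (\<Union>j\<le>i. F j)"] by blast
  have less: "fst (u i) < fst (u j)" "snd (u i) < snd (u j)" if "i < j" for i j
    using that mono[THEN strict_monoD] by auto
  have "similar (Suc i) (R i) (u i) (u (Suc i))" for i
    by (rule F(2)) (use u[of i] u[of "Suc i"] less in auto)
  then have "\<exists>Y. similar i (insert (X, Y) (R i)) (u i) (u (Suc i))" for i
    by simp
  then obtain Z where Z: "\<And>i. similar i (insert (X, Z i) (R i)) (u i) (u (Suc i))"
    by metis
  \<comment> \<open>The answer \<open>Z i\<close> is used from \<open>snd (u i)\<close> up to, but
    excluding, \<open>snd (u (Suc i))\<close>. Points below \<open>snd (u 0)\<close> get index 0 and
    lie in none of the intervals.\<close>
  define idx where "idx n = (LEAST i. n < snd (u (Suc i)))" for n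
  define Y where "Y = {n. n \<in> Z (idx n)}"
  have idx: "idx n = i" if "snd (u i) \<le> n" "n < snd (u (Suc i))" for n i
    using strict_mono_step_index[OF mono(2), of i n] that by (simp add: idx_def)
  have agree_Y: "n \<in> Y \<longleftrightarrow> n \<in> Z i" if n: "n \<in> {snd (u i)..snd (u (Suc i))}" for n i
  proof (cases "n < snd (u (Suc i))")
    case True
    then show ?thesis
      using n idx by (simp add: Y_def)
  next
    case False
    then have n: "n = snd (u (Suc i))"
      using n by simp
    \<comment> \<open>At the right end \<open>idx\<close> already switches to \<open>Suc i\<close>;
      both answers there say whether \<open>fst (u (Suc i))\<close> is in \<open>X\<close>.\<close>
    have "n \<in> Z i \<longleftrightarrow> fst (u (Suc i)) \<in> X"
      using similar_ends(2)[OF Z[of i], of X "Z i"] less[of i "Suc i"] by (simp add: n)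
    also have "\<dots> \<longleftrightarrow> n \<in> Z (Suc i)"
      using similar_ends(1)[OF Z[of "Suc i"], of X "Z (Suc i)"] less[of "Suc i" "Suc (Suc i)"]
      by (simp add: n)
    also have "\<dots> \<longleftrightarrow> n \<in> Y"
      using idx[of "Suc i" n] less[of "Suc i" "Suc (Suc i)"] by (simp add: Y_def n)
    finally show ?thesis ..
  qed
  have sim: "similar i (insert (X, Y) (R i)) (u i) (u (Suc i))" for i
    by (rule similar_insert_cong[OF Z[of i]]) (use less[of i "Suc i"] agree_Y[of _ i] in auto)
  define t where "t = (insert (X, Y) f, range u)"
  have "good t"
    unfolding good_def
  proof (intro conjI allI impI)
    show "countable (fst t)"
      using \<open>countable f\<close> by (simp add: t_def)
    show "infinite (snd t)"
      using strict_mono_enum_infinite(1)[OF mono(1)] by (simp add: t_def)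
    show "\<forall>x\<in>snd t. \<forall>y\<in>snd t. fst x < fst y \<longleftrightarrow> snd x < snd y"
      using strict_mono_less[OF mono(1)] strict_mono_less[OF mono(2)] by (auto simp: t_def)
    fix k S
    assume S: "finite S" "S \<subseteq> fst t"
    then have "S - {(X, Y)} \<subseteq> f"
      by (auto simp: t_def)
    then obtain i where "\<forall>j\<ge>i. S - {(X, Y)} \<subseteq> R j"
      using R(3)[of "S - {(X, Y)}"] S(1) by auto
    \<comment> \<open>From \<open>k\<close> on enough rounds are left; from \<open>i\<close> on the
      old pairs of \<open>S\<close> lie in \<open>R j\<close>.\<close>
    then have step: "similar k S (u j) (u (Suc j))" if "max i k \<le> j" for j
      using that
      by (intro similar_subset[OF similar_level_mono[OF sim[of j]]] less[THEN less_imp_le]) auto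
    have *: "similar k S (u a) (u b)" if "max i k \<le> a" "a < b" for a b
      using similar_sequence[OF mono step that] .
    have "similar k S x y"
      if x: "x \<in> range u - u ` {..<max i k}" and y: "y \<in> range u - u ` {..<max i k}"
        and xy: "fst x < fst y" for x y
    proof -
      obtain a b where ab: "x = u a" "y = u b"
        using x y by auto
      then have "max i k \<le> a"
        using x by (metis DiffD2 image_eqI lessThan_iff not_le)
      moreover have "a < b"
        using strict_mono_less[OF mono(1), of a b] xy ab by simp
      ultimately show ?thesis
        using * ab by blast
    qed
    then show "\<exists>F. finite F \<and> (\<forall>x\<in>snd t - F. \<forall>y\<in>snd t - F. fst x < fst y \<longrightarrow> similar k S x y)"
      by (intro exI[of _ "u ` {..<max i k}"]) (auto simp: t_def)
  qed
  moreover have "range u \<subseteq> P"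
    using u by blast
  then have "below s t"
    by (auto simp: below_def s t_def Diff_eq_empty_iff[THEN iffD2])
  ultimately show thesis
    by (rule that[of t Y]) (simp add: t_def)
qed

text \<open>The domain case, applied to the inverse stage.\<close>

lemma good_extend_range:
  assumes "good s"
  obtains t X where "good t" "below s t" "(X, Y) \<in> fst t"
proof -
  have inv: "P\<inverse> - Q\<inverse> = (P - Q)\<inverse>" for P Q :: "(nat \<times> nat) set"
    by auto
  have "good ((fst s)\<inverse>, (snd s)\<inverse>)"
    using good_swap[of "fst s" "snd s"] assms by simp
  then obtain t X where t: "good t" "below ((fst s)\<inverse>, (snd s)\<inverse>) t" "(Y, X) \<in> fst t"
    by (rule good_extend_domain)
  show thesis
  proof (rule that)
    show "good ((fst t)\<inverse>, (snd t)\<inverse>)"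
      using good_swap[of "fst t" "snd t"] t(1) by simp
    have "finite ((snd t)\<inverse> - snd s)"
      using t(2) inv[of "snd t" "(snd s)\<inverse>"] by (simp add: below_def)
    then show "below s ((fst t)\<inverse>, (snd t)\<inverse>)"
      using t(2) by (auto simp: below_def)
    show "(X, Y) \<in> fst ((fst t)\<inverse>, (snd t)\<inverse>)"
      using t(3) by simp
  qed
qed

section \<open>The initial stage\<close>

text \<open>Dependent choice of cuts from \<open>similar_spaced_intervals\<close>: the two sequences
  interleave with gaps of at least \<open>i\<close>, and the \<open>i\<close>-th intervals are
  similar for \<open>i\<close> rounds.\<close>

lemma good_base:
  obtains p q :: "nat \<Rightarrow> nat" where "good ({(range p, range q)}, range (\<lambda>i. (p i, q i)))"
    "\<And>i. q i + i < p (Suc i)" "\<And>i. p i + i \<le> q i"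
proof -
  \<comment> \<open>The slack \<open>Suc i\<close> is the gap required between the coordinates of
    \<open>v\<close>, the cut pair of index \<open>Suc i\<close>.\<close>
  define step where "step i u v \<longleftrightarrow> similar i {({fst u, fst v}, {snd u, snd v})} u v \<and>
      snd u + Suc i < fst v \<and> fst v + Suc i < snd v" for i and u v :: "nat \<times> nat"
  have "\<exists>u. \<forall>i. fst (u i) + i \<le> snd (u i) \<and> step i (u i) (u (Suc i))"
  proof (intro dependent_nat_choice)
    show "\<exists>u :: nat \<times> nat. fst u + 0 \<le> snd u"
      by auto
    show "\<exists>v. fst v + Suc i \<le> snd v \<and> step i u v" for u i
    proof -
      obtain p' q' where "similar i {({fst u, p'}, {snd u, q'})} (fst u, snd u) (p', q')"
        "snd u + Suc i < p'" "p' + Suc i < q'"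
        by (rule similar_spaced_intervals)
      then show ?thesis
        by (intro exI[of _ "(p', q')"]) (simp add: step_def)
    qed
  qed
  then obtain u where u: "\<And>i. fst (u i) + i \<le> snd (u i)" "\<And>i. step i (u i) (u (Suc i))"
    by blast
  define p q where "p = fst \<circ> u" and "q = snd \<circ> u"
  have ineq: "q i + i < p (Suc i)" "p i + i \<le> q i" for i
    using u[of i] by (simp_all add: step_def p_def q_def)
  have mono: "strict_mono p" "strict_mono q"
  proof -
    have "p i < p (Suc i) \<and> q i < q (Suc i)" for i
      using ineq[of i] ineq[of "Suc i"] by linarith
    then show "strict_mono p" "strict_mono q"
      by (simp_all add: strict_mono_Suc_iff)
  qed
  \<comment> \<open>Between consecutive cuts \<open>range g\<close> has only the two ends, so the
    marks of the separate intervals fit together to \<open>range p\<close> and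
    \<open>range q\<close>.\<close>
  have range: "n \<in> range g \<longleftrightarrow> n \<in> {g i, g (Suc i)}"
    if "strict_mono g" "n \<in> {g i..g (Suc i)}" for g :: "nat \<Rightarrow> nat" and n i
  proof
    assume "n \<in> range g"
    then obtain j where j: "n = g j"
      by auto
    then have "i \<le> j" "j \<le> Suc i"
      using that strict_mono_less_eq[OF that(1)] by auto
    then show "n \<in> {g i, g (Suc i)}"
      using j by (auto simp: le_Suc_eq)
  qed auto
  have sim: "similar i {(range p, range q)} (u i) (u (Suc i))" for i
  proof (rule similar_cong)
    show "similar i {({p i, p (Suc i)}, {q i, q (Suc i)})} (u i) (u (Suc i))"
      using u(2)[of i] by (simp add: step_def p_def q_def)
    show "fst (u i) \<le> fst (u (Suc i))" "snd (u i) \<le> snd (u (Suc i))"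
      using strict_monoD[OF mono(1), of i "Suc i"] strict_monoD[OF mono(2), of i "Suc i"]
      by (simp_all add: p_def q_def)
    fix A' B'
    assume "(A', B') \<in> {(range p, range q)}"
    then show "\<exists>(A, B)\<in>{({p i, p (Suc i)}, {q i, q (Suc i)})}.
        (\<forall>n\<in>{fst (u i)..fst (u (Suc i))}. n \<in> A' \<longleftrightarrow> n \<in> A) \<and>
        (\<forall>n\<in>{snd (u i)..snd (u (Suc i))}. n \<in> B' \<longleftrightarrow> n \<in> B)"
      using range[OF mono(1), of _ i] range[OF mono(2), of _ i] by (simp add: p_def q_def)
  qed
  have mono': "strict_mono (fst \<circ> u)" "strict_mono (snd \<circ> u)"
    using mono by (simp_all add: p_def q_def)
  have "range (\<lambda>i. (p i, q i)) = range u"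
    by (simp add: p_def q_def)
  moreover have "good ({(range p, range q)}, range u)"
    unfolding good_def fst_conv snd_conv
  proof (intro conjI allI impI)
    show "infinite (range u)"
      using strict_mono_enum_infinite(1)[OF mono'(1)] .
    show "\<forall>x\<in>range u. \<forall>y\<in>range u. fst x < fst y \<longleftrightarrow> snd x < snd y"
      using strict_mono_less[OF mono'(1)] strict_mono_less[OF mono'(2)] by auto
    fix k R
    assume R: "R \<subseteq> {(range p, range q)}"
    have step: "similar k R (u j) (u (Suc j))" if "k \<le> j" for j
      using that strict_monoD[OF mono'(1), of j "Suc j"] strict_monoD[OF mono'(2), of j "Suc j"]
      by (intro similar_subset[OF similar_level_mono[OF sim[of j]] _ _ R]) auto
    have *: "similar k R (u a) (u b)" if "k \<le> a" "a < b" for a b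
      using similar_sequence[OF mono' step that] .
    have "similar k R x y"
      if x: "x \<in> range u - u ` {..<k}" and y: "y \<in> range u - u ` {..<k}"
        and xy: "fst x < fst y" for x y
    proof -
      obtain a b where ab: "x = u a" "y = u b"
        using x y by auto
      then have "k \<le> a"
        using x by (metis DiffD2 image_eqI lessThan_iff not_le)
      moreover have "a < b"
        using strict_mono_less[OF mono'(1), of a b] xy ab by simp
      ultimately show ?thesis
        using * ab by blast
    qed
    then show "\<exists>F. finite F \<and> (\<forall>x\<in>range u - F. \<forall>y\<in>range u - F. fst x < fst y \<longrightarrow> similar k R x y)"
      by (intro exI[of _ "u ` {..<k}"]) auto
  qed simp
  ultimately show thesis
    by (intro that[of p q] ineq) simp
qed

section \<open>Transfer of finiteness along a stage\<close>

text \<open>Beyond any bound \<open>b\<close> some interval between cuts contains a point of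
  \<open>M\<close>; the game of length 0 matches it with a point of \<open>N\<close> that is at
  least \<open>b\<close>. The hypothesis on \<open>Suc m\<close> and \<open>Suc n\<close> admits
  properties that look one step ahead.\<close>

lemma good_infinite_transfer:
  assumes "good (f, P)" "finite R" "R \<subseteq> f" "infinite M"
    and iff: "\<And>m n. agree R m n \<Longrightarrow> agree R (Suc m) (Suc n) \<Longrightarrow> m \<in> M \<Longrightarrow> n \<in> N"
  shows "infinite N"
  unfolding infinite_nat_iff_unbounded_le
proof
  fix b
  obtain F where F: "finite F"
    "\<And>u v. u \<in> P - F \<Longrightarrow> v \<in> P - F \<Longrightarrow> fst u < fst v \<Longrightarrow> similar 0 R u v"
    using good_similar[OF assms(1,2), of 0] assms(3) by auto
  have "infinite (P - F)"
    using assms(1) F(1) by (simp add: good_def)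
  moreover have "fst u < fst v \<longleftrightarrow> snd u < snd v" if "u \<in> P - F" "v \<in> P - F" for u v
    using good_order[OF assms(1)] that by simp
  ultimately obtain u where u: "\<And>i :: nat. u i \<in> P - F"
    and mono: "strict_mono (fst \<circ> u)" "strict_mono (snd \<circ> u)"
    using increasing_selection[of "P - F" "\<lambda>_. P - F"] by blast
  obtain m where m: "m \<in> M" "fst (u b) \<le> m"
    using assms(4) unfolding infinite_nat_iff_unbounded_le by blast
  \<comment> \<open>A strictly increasing sequence of naturals dominates its index, so
    \<open>Suc m\<close> indexes a cut beyond \<open>m\<close>.\<close>
  have v: "m < fst (u (Suc m))" "b \<le> snd (u b)"
    using strict_mono_imp_increasing[OF mono(1), of "Suc m"]
      strict_mono_imp_increasing[OF mono(2), of b] by auto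
  then have "similar 0 R (u b) (u (Suc m))"
    using m(2) by (intro F(2) u) simp
  then obtain n where "n \<in> {snd (u b)..<snd (u (Suc m))}" "agree R m n" "agree R (Suc m) (Suc n)"
    using m v unfolding similar.simps by (meson atLeastLessThan_iff)
  then show "\<exists>n\<ge>b. n \<in> N"
    using iff m(1) v(2) by (meson atLeastLessThan_iff order_trans)
qed

text \<open>Meant for \<open>M\<close> and \<open>N\<close> given by one Boolean condition on the
  traces at a point and its successor. Equality modulo finite sets, Boolean identities and the shift
  are all of this form.\<close>

lemma good_finite_iff:
  assumes "good (f, P)" "finite R" "R \<subseteq> f"
    and iff: "\<And>m n. agree R m n \<Longrightarrow> agree R (Suc m) (Suc n) \<Longrightarrow> m \<in> M \<longleftrightarrow> n \<in> N"
  shows "finite M \<longleftrightarrow> finite N"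
proof -
  have conv: "agree (R\<inverse>) n m \<longleftrightarrow> agree R m n" for m n
    by (auto simp: agree_def)
  have "infinite N" if "infinite M"
    by (rule good_infinite_transfer[OF assms(1-3) that]) (use iff in blast)
  moreover have "infinite M" if "infinite N"
    by (rule good_infinite_transfer[OF good_swap[OF assms(1)] _ _ that, of "R\<inverse>"])
      (use assms(2,3) iff in \<open>auto simp: conv\<close>)
  ultimately show ?thesis
    by blast
qed

section \<open>The transfinite recursion under CH\<close>

text \<open>Initial segments of the cardinal order on the sets of naturals have smaller cardinality,
  thus under CH less than \<open>cardSuc natLeq\<close>, that is, at most
  \<open>natLeq\<close>.\<close>

lemma CH_countable_underS:
  assumes CH
  obtains r :: "nat set rel" where "Well_order r" "Field r = UNIV" "\<And>a. countable (underS r a)"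
proof (rule that[of "|UNIV :: nat set set|"])
  show "countable (underS |UNIV :: nat set set| a)" for a
  proof -
    have "|underS |UNIV :: nat set set| a| <o |UNIV :: nat set set|"
      by (rule card_of_underS[OF card_of_Card_order]) (simp add: Field_card_of)
    then have "|underS |UNIV :: nat set set| a| <o cardSuc natLeq"
      using assms ordLess_ordIso_trans unfolding CH_def by blast
    then have "|underS |UNIV :: nat set set| a| \<le>o natLeq"
      using cardSuc_ordLeq_ordLess[OF natLeq_Card_order card_of_Card_order] by blast
    then have "|underS |UNIV :: nat set set| a| \<le>o |UNIV :: nat set|"
      using card_of_nat ordIso_symmetric ordLeq_ordIso_trans by blast
    then have "\<exists>f. inj_on f (underS |UNIV :: nat set set| a) \<and>
        f ` underS |UNIV :: nat set set| a \<subseteq> (UNIV :: nat set)"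
      by (rule iffD2[OF card_of_ordLeq])
    then show ?thesis
      by (auto simp: countable_def)
  qed
qed (rule card_of_Well_order Field_card_of)+

text \<open>The index of a step is the set to be handled: stage \<open>a\<close> puts
  \<open>a\<close> both into the domain and into the range. Initial segments are countable, so
  \<open>chain_upper_bound\<close> applies to the earlier stages.\<close>

lemma good_tower:
  assumes CH "good s0"
  obtains S where "s0 \<in> S" "\<And>s. s \<in> S \<Longrightarrow> good s"
    "\<And>s t. s \<in> S \<Longrightarrow> t \<in> S \<Longrightarrow> fst s \<subseteq> fst t \<or> fst t \<subseteq> fst s"
    "\<And>X. \<exists>s\<in>S. \<exists>Y. (X, Y) \<in> fst s" "\<And>Y. \<exists>s\<in>S. \<exists>X. (X, Y) \<in> fst s"
proof -
  obtain r :: "nat set rel" where r: "Well_order r" "Field r = UNIV" "\<And>a. countable (underS r a)"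
    using CH_countable_underS[OF assms(1)] by blast
  define Q where "Q g a t \<longleftrightarrow> good t \<and> below s0 t \<and> (\<forall>b\<in>underS r a. below (g b) t) \<and>
      (\<exists>Y. (a, Y) \<in> fst t) \<and> (\<exists>X. (X, a) \<in> fst t)" for g a t
  have wf: "wf (r - Id)"
    using r(1) by (simp add: well_order_on_def)
  have under: "b \<in> underS r a \<longleftrightarrow> (b, a) \<in> r - Id" for a b
    by (auto simp: underS_def)
  have total: "(a, b) \<in> r - Id \<or> a = b \<or> (b, a) \<in> r - Id" for a b
    using r(1,2) by (auto simp: well_order_on_def linear_order_on_def total_on_def)
  have tr: "(a, c) \<in> r - Id" if "(a, b) \<in> r - Id" "(b, c) \<in> r - Id" for a b c
    using that r(1)
    by (auto simp: well_order_on_def linear_order_on_def partial_order_on_def preorder_on_def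
        dest: transD antisymD)
  have "\<exists>g. \<forall>a. Q g a (g a)"
  proof (rule dependent_wf_choice[OF wf])
    \<comment> \<open>\<open>Q g a t\<close> consults \<open>g\<close> only below \<open>a\<close>,
      as choice along a well-founded relation requires.\<close>
    show "Q f a t \<longleftrightarrow> Q g a t" if "\<And>z. (z, a) \<in> r - Id \<Longrightarrow> f z = g z" for f g a t
      using that by (auto simp: Q_def under)
    fix a g
    assume IH: "\<And>b. (b, a) \<in> r - Id \<Longrightarrow> Q g b (g b)"
    \<comment> \<open>Including \<open>s0\<close> makes the chain nonempty at the least
      \<open>a\<close> as well.\<close>
    have "\<exists>t. good t \<and> (\<forall>s\<in>insert s0 (g ` underS r a). below s t)"
    proof (rule chain_upper_bound)
      show "countable (insert s0 (g ` underS r a))"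
        using r(3) by simp
      show "good s" if "s \<in> insert s0 (g ` underS r a)" for s
        using that assms(2) IH by (auto simp: Q_def under)
      have "below (g b) (g c)" if "(b, c) \<in> r - Id" "(c, a) \<in> r - Id" for b c
        using IH[OF that(2)] that(1) by (auto simp: Q_def under)
      then have "below (g b) (g c) \<or> below (g c) (g b)"
        if "(b, a) \<in> r - Id" "(c, a) \<in> r - Id" for b c
        using total[of b c] that below_refl by metis
      moreover have "below s0 (g b)" if "(b, a) \<in> r - Id" for b
        using IH[OF that] by (simp add: Q_def)
      ultimately show "below s t \<or> below t s"
        if "s \<in> insert s0 (g ` underS r a)" "t \<in> insert s0 (g ` underS r a)" for s t
        using that unfolding under[symmetric] by (auto intro: below_refl)
    qed simp
    then obtain t where t: "good t" "\<And>s. s \<in> insert s0 (g ` underS r a) \<Longrightarrow> below s t"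
      by blast
    obtain t' Y where t': "good t'" "below t t'" "(a, Y) \<in> fst t'"
      by (rule good_extend_domain[OF t(1)])
    obtain t'' X where t'': "good t''" "below t' t''" "(X, a) \<in> fst t''"
      by (rule good_extend_range[OF t'(1)])
    have "below s t''" if "s \<in> insert s0 (g ` underS r a)" for s
      using below_trans[OF t(2)[OF that] below_trans[OF t'(2) t''(2)]] .
    moreover have "(a, Y) \<in> fst t''"
      using t'(3) t''(2) by (auto simp: below_def)
    ultimately show "\<exists>t. Q g a t"
      using t''(1,3) unfolding Q_def by (intro exI[of _ t'']) blast
  qed
  then obtain g where g: "\<And>a. Q g a (g a)"
    by blast
  have "below (g b) (g c) \<or> below (g c) (g b)" for b c
    using total[of b c] g below_refl by (metis Q_def under)
  moreover have "below s0 (g b)" for b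
    using g by (simp add: Q_def)
  ultimately have "below s t \<or> below t s"
    if "s \<in> insert s0 (range g)" "t \<in> insert s0 (range g)" for s t
    using that by (auto intro: below_refl)
  then have "fst s \<subseteq> fst t \<or> fst t \<subseteq> fst s"
    if "s \<in> insert s0 (range g)" "t \<in> insert s0 (range g)" for s t
    using that unfolding below_def by blast
  moreover have "good s" if "s \<in> insert s0 (range g)" for s
    using that assms(2) g by (auto simp: Q_def)
  moreover have "\<exists>s\<in>insert s0 (range g). \<exists>Y. (X, Y) \<in> fst s" for X
    using g[of X] by (auto simp: Q_def)
  moreover have "\<exists>s\<in>insert s0 (range g). \<exists>X. (X, Y) \<in> fst s" for Y
    using g[of Y] by (auto simp: Q_def)
  ultimately show thesis
    using that[of "insert s0 (range g)"] by blast
qed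

section \<open>The induced automorphism\<close>

lemma cls_eq_iff: "cls A = cls B \<longleftrightarrow> finite ((A - B) \<union> (B - A))"
  by (metis eq_mod_fin_def pfin.abs_eq_iff)

lemma cls_cases: obtains A where "x = cls A"
  by (metis Quotient3_abs_rep Quotient3_pfin)

lemma shift_funpow_cls: "(shift ^^ n) (cls A) = cls ((\<lambda>m. m + n) ` A)"
proof (induction n)
  case (Suc n)
  then show ?case
    by (simp add: shift_cls image_image)
qed simp

text \<open>Past an index depending on \<open>n\<close>, a point of one sequence exceeds every
  earlier point of the other by more than \<open>n\<close> and stays below every later one, so the
  translate by \<open>n\<close> misses it. The two claims serve nonnegative and negative
  exponents.\<close>

lemma cls_range_neq_shift:
  fixes p q :: "nat \<Rightarrow> nat"
  assumes "strict_mono p" "strict_mono q" "\<And>i. p i + i \<le> q i" "\<And>i. q i + i < p (Suc i)"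
  shows "cls (range q) \<noteq> (shift ^^ n) (cls (range p))" "cls (range p) \<noteq> (shift ^^ n) (cls (range q))"
proof -
  have "q i \<noteq> p j + n" if "n < i" for i j
  proof (cases "j \<le> i")
    case True
    then have "p j \<le> p i"
      using strict_mono_less_eq[OF assms(1)] by simp
    then show ?thesis
      using assms(3)[of i] that by linarith
  next
    case False
    then have "p (Suc i) \<le> p j"
      using strict_mono_less_eq[OF assms(1)] by simp
    then show ?thesis
      using assms(4)[of i] by linarith
  qed
  then have "q ` {n<..} \<subseteq> range q - (\<lambda>m. m + n) ` range p"
    by auto
  moreover have "infinite (q ` {n<..})"
    using strict_mono_imp_inj_on[OF assms(2)] infinite_Ioi[of n] by (metis finite_imageD inj_on_subset subset_UNIV)
  ultimately show "cls (range q) \<noteq> (shift ^^ n) (cls (range p))"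
    unfolding shift_funpow_cls cls_eq_iff by (meson finite_subset finite_Un)
next
  have "p (Suc i) \<noteq> q j + n" if "n < i" for i j
  proof (cases "j \<le> i")
    case True
    then have "q j \<le> q i"
      using strict_mono_less_eq[OF assms(2)] by simp
    then show ?thesis
      using assms(4)[of i] that by linarith
  next
    case False
    then have "q (Suc i) \<le> q j"
      using strict_mono_less_eq[OF assms(2)] by simp
    then show ?thesis
      using assms(3)[of "Suc i"] by linarith
  qed
  then have "(p \<circ> Suc) ` {n<..} \<subseteq> range p - (\<lambda>m. m + n) ` range q"
    by auto
  moreover have "inj (p \<circ> Suc)"
    using strict_mono_imp_inj_on[OF assms(1)] by (simp add: inj_compose)
  then have "infinite ((p \<circ> Suc) ` {n<..})"
    using infinite_Ioi[of n] by (metis finite_imageD inj_on_subset subset_UNIV)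
  ultimately show "cls (range p) \<noteq> (shift ^^ n) (cls (range q))"
    unfolding shift_funpow_cls cls_eq_iff by (meson finite_subset finite_Un)
qed

theorem theorem12p8:
  assumes CH
  shows "\<exists>\<phi> :: pfin \<Rightarrow> pfin. ba_automorphism \<phi> \<and> \<phi> \<circ> shift = shift \<circ> \<phi> \<and>
           (\<forall>n :: int. \<phi> \<noteq> int_funpow shift n)"
proof -
  obtain p q :: "nat \<Rightarrow> nat" where base: "good ({(range p, range q)}, range (\<lambda>i. (p i, q i)))"
    and pq: "\<And>i. q i + i < p (Suc i)" "\<And>i. p i + i \<le> q i"
    using good_base by blast
  have "p i < p (Suc i) \<and> q i < q (Suc i)" for i
    using pq(1)[of i] pq(2)[of i] pq(2)[of "Suc i"] by linarith
  then have mono: "strict_mono p" "strict_mono q"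
    by (simp_all add: strict_mono_Suc_iff)
  obtain S where S: "({(range p, range q)}, range (\<lambda>i. (p i, q i))) \<in> S" "\<And>s. s \<in> S \<Longrightarrow> good s"
    "\<And>s t. s \<in> S \<Longrightarrow> t \<in> S \<Longrightarrow> fst s \<subseteq> fst t \<or> fst t \<subseteq> fst s"
    "\<And>X. \<exists>s\<in>S. \<exists>Y. (X, Y) \<in> fst s" "\<And>Y. \<exists>s\<in>S. \<exists>X. (X, Y) \<in> fst s"
    using good_tower[OF assms base] by blast
  define f where "f = (\<Union>s\<in>S. fst s)"
  \<comment> \<open>\<open>R\<close> is finite, so a single stage of the tower contains it.\<close>
  have transfer: "finite M \<longleftrightarrow> finite N"
    if R: "finite R" "R \<subseteq> f"
      and iff: "\<And>m n. agree R m n \<Longrightarrow> agree R (Suc m) (Suc n) \<Longrightarrow> m \<in> M \<longleftrightarrow> n \<in> N" for R M N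
  proof -
    obtain s where s: "s \<in> S" "R \<subseteq> fst s"
      using finite_subset_chain_union[OF R(1), of S] R(2) S(1,3) unfolding f_def by blast
    show ?thesis
      by (rule good_finite_iff[of "fst s" "snd s" R]) (use S(2)[OF s(1)] s(2) R(1) iff in simp_all)
  qed
  \<comment> \<open>The two directions say that \<open>f\<close> is well defined and injective on
    classes.\<close>
  have cls_iff: "cls A = cls A' \<longleftrightarrow> cls B = cls B'" if "(A, B) \<in> f" "(A', B') \<in> f" for A A' B B'
    unfolding cls_eq_iff by (rule transfer[of "{(A, B), (A', B')}"]) (use that in \<open>auto simp: agree_def\<close>)
  \<comment> \<open>\<open>f\<close> is only a relation between sets; \<open>b\<close> and
    \<open>a\<close> choose an image and a preimage, which \<open>cls_iff\<close> makes unique up to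
    finite sets.\<close>
  obtain b where b: "\<And>A. (A, b A) \<in> f"
    using S(4) unfolding f_def by (metis UN_I)
  obtain a where a: "\<And>B. (a B, B) \<in> f"
    using S(5) unfolding f_def by (metis UN_I)
  define \<phi> where "\<phi> x = cls (b (rep_pfin x))" for x
  have \<phi>: "\<phi> (cls A) = cls B" if "(A, B) \<in> f" for A B
    using cls_iff[OF b that] unfolding \<phi>_def by (metis Quotient3_abs_rep Quotient3_pfin)
  have inj: "inj \<phi>"
  proof (rule injI)
    fix x y
    assume "\<phi> x = \<phi> y"
    moreover obtain A A' where "x = cls A" "y = cls A'"
      by (metis cls_cases)
    ultimately show "x = y"
      using \<phi>[OF b[of A]] \<phi>[OF b[of A']] cls_iff[OF b[of A] b[of A']] by simp
  qed
  have surj: "surj \<phi>"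
    by (rule surjI[of _ "\<lambda>y. cls (a (rep_pfin y))"])
      (simp add: \<phi>[OF a], metis Quotient3_abs_rep Quotient3_pfin)
  have inf: "\<phi> (inf x y) = inf (\<phi> x) (\<phi> y)" for x y
  proof -
    obtain A A' where A: "x = cls A" "y = cls A'"
      by (metis cls_cases)
    \<comment> \<open>The left side holds trivially; \<open>transfer\<close> carries it to the
      images.\<close>
    have "cls (A \<inter> A') = cls (A \<inter> A') \<longleftrightarrow> cls (b (A \<inter> A')) = cls (b A \<inter> b A')"
      unfolding cls_eq_iff
      by (rule transfer[of "{(A, b A), (A', b A'), (A \<inter> A', b (A \<inter> A'))}"])
        (use b in \<open>auto simp: agree_def\<close>)
    then show ?thesis
      by (simp add: A inf_pfin.abs_eq \<phi>[OF b])
  qed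
  have compl: "\<phi> (- x) = - \<phi> x" for x
  proof -
    obtain A where A: "x = cls A"
      by (metis cls_cases)
    have "cls (- A) = cls (- A) \<longleftrightarrow> cls (b (- A)) = cls (- b A)"
      unfolding cls_eq_iff
      by (rule transfer[of "{(A, b A), (- A, b (- A))}"]) (use b in \<open>auto simp: agree_def\<close>)
    then show ?thesis
      by (simp add: A uminus_pfin.abs_eq \<phi>[OF b])
  qed
  have sup: "\<phi> (sup x y) = sup (\<phi> x) (\<phi> y)" for x y
    using inf[of "- x" "- y"] compl by (metis compl_inf double_compl)
  have bot: "\<phi> bot = bot"
    using inf[of bot "- bot"] compl[of bot] by (metis inf_compl_bot)
  then have top: "\<phi> top = top"
    using compl[of bot] by simp
  have "\<phi> (shift x) = shift (\<phi> x)" for x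
  proof -
    obtain A where A: "x = cls A"
      by (metis cls_cases)
    define A' where "A' = (\<lambda>n. n + 1) ` A"
    \<comment> \<open>\<open>M\<close> and \<open>N\<close> compare a point with its successor, so
      \<open>transfer\<close> is used here with its successor clause.\<close>
    define M where "M = {m. \<not> (Suc m \<in> A' \<longleftrightarrow> m \<in> A)}"
    define N where "N = {n. \<not> (Suc n \<in> b A' \<longleftrightarrow> n \<in> b A)}"
    have "M = {}"
      by (auto simp: M_def A'_def)
    moreover have "finite M \<longleftrightarrow> finite N"
      by (rule transfer[of "{(A, b A), (A', b A')}"])
        (use b in \<open>auto simp: agree_def M_def N_def\<close>)
    \<comment> \<open>0 has no predecessor, so \<open>N\<close> says nothing about it and it is
      added by hand.\<close>
    ultimately have "finite (insert 0 (Suc ` N))"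
      by simp
    moreover have "(b A' - (\<lambda>n. n + 1) ` b A) \<union> ((\<lambda>n. n + 1) ` b A - b A') \<subseteq> insert 0 (Suc ` N)"
    proof
      fix n
      assume "n \<in> (b A' - (\<lambda>n. n + 1) ` b A) \<union> ((\<lambda>n. n + 1) ` b A - b A')"
      then show "n \<in> insert 0 (Suc ` N)"
        by (cases n) (auto simp: N_def)
    qed
    ultimately have "cls (b A') = cls ((\<lambda>n. n + 1) ` b A)"
      unfolding cls_eq_iff by (rule rev_finite_subset)
    then show ?thesis
      by (simp add: A shift_cls \<phi>[OF b] A'_def)
  qed
  then have comm: "\<phi> \<circ> shift = shift \<circ> \<phi>"
    by auto
  have "(range p, range q) \<in> f"
    using S(1) by (force simp: f_def)
  then have val: "\<phi> (cls (range p)) = cls (range q)"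
    by (rule \<phi>)
  have "\<phi> \<noteq> int_funpow shift n" for n
  proof
    assume eq: "\<phi> = int_funpow shift n"
    show False
    proof (cases "0 \<le> n")
      case True
      then show False
        using cls_range_neq_shift(1)[OF mono pq(2,1), of "nat n"] val eq by (simp add: int_funpow_def)
    next
      case False
      then have "cls (range q) = (inv shift ^^ nat (- n)) (cls (range p))"
        using val eq by (simp add: int_funpow_def)
      \<comment> \<open>Applying the power of \<open>shift\<close> cancels the inverse and leads to
        the second inequality.\<close>
      then have "(shift ^^ nat (- n)) (cls (range q)) = cls (range p)"
        using bij_is_surj[OF bij_shift] by (simp add: inv_fn bij_shift bij_fn surj_f_inv_f flip: inv_fn)
      then show False
        using cls_range_neq_shift(2)[OF mono pq(2,1), of "nat (- n)"] by simp
    qed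
  qed
  then show ?thesis
    using inj surj inf sup compl bot top comm by (auto simp: ba_automorphism_def bij_def)
qed

end
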